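(* Let $d \in \mathbb{N}$, let $r > 0$ be a real number, and let $\boldsymbol{x} = (x_1,\dots,x_d) \in [0,1]^d$ be such that $\|\boldsymbol{x}\|_1 = \sum_{i=1}^d |x_i| < 1$. Let $\boldsymbol{\eta} = (\eta_1,\dots,\eta_d) \sim \mathrm{Neg\,Multinomial}(r,\boldsymbol{x})$, and put $y_i = x_i/(1 - \|\boldsymbol{x}\|_1)$ for all $i \in \{1,\dots,d\}$. Then, for all $p_1,\dots,p_d \in \mathbb{N}_0$, $$\mathbb{E}\left[\prod_{i=1}^d \eta_i^{p_i}\right] = \sum_{k_1=0}^{p_1} \cdots \sum_{k_d=0}^{p_d} \left(r - 1 + \|\boldsymbol{k}\|_1\right)^{(\|\boldsymbol{k}\|_1)} \prod_{i=1}^d \left\{ {p_i \atop k_i} \right\} y_i^{k_i},$$ where $\boldsymbol{k} = (k_1,\dots,k_d)$.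
   Context: Notation: $\mathbb{N} = \{1,2,\dots\}$, $\mathbb{N}_0 = \{0,1,2,\dots\}$, and $\|\boldsymbol{v}\|_1 = \sum_{i=1}^d |v_i|$ for $\boldsymbol{v} \in \mathbb{R}^d$. Negative multinomial distribution: for $d \in \mathbb{N}$, a real $r > 0$, and $\boldsymbol{x} \in [0,1]^d$ with $\|\boldsymbol{x}\|_1 < 1$, a random vector $\boldsymbol{\eta}$ with values in $\mathbb{N}_0^d$ satisfies $\boldsymbol{\eta} \sim \mathrm{Neg\,Multinomial}(r,\boldsymbol{x})$ if its probability mass function is $$P_{r,\boldsymbol{x}}(\boldsymbol{k}) = \frac{\Gamma(r + \|\boldsymbol{k}\|_1)}{\Gamma(r) \prod_{i=1}^d \Gamma(k_i + 1)} (1 - \|\boldsymbol{x}\|_1)^r \prod_{i=1}^d x_i^{k_i}, \qquad \boldsymbol{k} = (k_1,\dots,k_d) \in \mathbb{N}_0^d.$$ Falling factorial: for $m \in \mathbb{R}$ and $k \in \mathbb{N}_0$, $m^{(k)} = m(m-1)\cdots(m-k+1)$, with $m^{(0)} = 1$ (empty product). Stirling number of the second kind: $\left\{ {p \atop k} \right\}$ is the number of ways to partition a set of $p$ objects into $k$ non-empty subsets (in particular $\left\{ {0 \atop 0} \right\} = 1$, and $\left\{ {p \atop 0} \right\} = 0$ for $p \geq 1$). The convention $0^0 = 1$ is used for powers with exponent zero. *)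

theory Defs
  imports "HOL-Probability.Probability" "HOL-Combinatorics.Stirling"
begin

text \<open>
  Dimension \<open>d \<ge> 1\<close> is rendered by an arbitrary finite index type \<open>'n\<close>, so that
  vectors in \<open>[0,1]^d\<close> have type \<open>real^'n\<close> and multi-indices in \<open>N_0^d\<close> have type \<open>nat^'n\<close>.
\<close>

definition l1_norm :: "real^'n \<Rightarrow> real" where
  "l1_norm v = (\<Sum>i\<in>UNIV. \<bar>v $ i\<bar>)"

text \<open>The \<open>l1\<close> norm of a multi-index, kept in \<open>nat\<close> so that it can also serve as an exponent.\<close>

definition multi_size :: "nat^'n \<Rightarrow> nat" where
  "multi_size k = (\<Sum>i\<in>UNIV. k $ i)"

lemma of_nat_multi_size: "real (multi_size k) = l1_norm (\<chi> i. real (k $ i))"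
  by (simp add: multi_size_def l1_norm_def)

text \<open>\<open>powr\<close> is only applied to the positive base \<open>1 - l1_norm x\<close>; the powers with
  natural exponents satisfy \<open>0 ^ 0 = 1\<close>.\<close>

definition neg_multinomial_pmf :: "real \<Rightarrow> real^'n \<Rightarrow> nat^'n \<Rightarrow> real" where
  "neg_multinomial_pmf r x k =
     Gamma (r + real (multi_size k)) / (Gamma r * (\<Prod>i\<in>UNIV. Gamma (real (k $ i) + 1)))
       * (1 - l1_norm x) powr r * (\<Prod>i\<in>UNIV. (x $ i) ^ (k $ i))"

definition falling_factorial :: "real \<Rightarrow> nat \<Rightarrow> real" where
  "falling_factorial m k = (\<Prod>j<k. m - real j)"

text \<open>The recursively defined \<^const>\<open>Stirling\<close> counts partitions into non-empty blocks.\<close>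

lemma card_partitions_insert:
  assumes fin: "finite A" and a: "a \<notin> A"
  shows "card {P. partition_on (insert a A) P \<and> card P = Suc k} =
         Suc k * card {P. partition_on A P \<and> card P = Suc k} +
         card {P. partition_on A P \<and> card P = k}"
proof -
  define S where "S m = {P. partition_on A P \<and> card P = m}" for m
  define f where "f = (\<lambda>(P, B). insert (insert a B) (P - {B}))"
  have finS: "finite (S m)" for m
    using finitely_many_partition_on[OF fin] by (auto simp: S_def intro: rev_finite_subset)
  have SD: "finite P" "\<Union>P = A" "{} \<notin> P" "disjoint P" "card P = m" "\<And>B. B \<in> P \<Longrightarrow> a \<notin> B"
    if "P \<in> S m" for P m
    using that a finite_elements[OF fin] by (auto simp: S_def partition_on_def)
  have sub1: "insert {a} P \<in> {P. partition_on (insert a A) P \<and> card P = Suc k}" if "P \<in> S k" for P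
  proof -
    note SD = SD[OF that]
    have "{a} \<notin> P" using SD(6) by auto
    then show ?thesis using SD a
      by (auto simp: partition_on_def disjoint_def card_insert_if)
  qed
  have sub2: "f (P, B) \<in> {P. partition_on (insert a A) P \<and> card P = Suc k}"
    if "P \<in> S (Suc k)" "B \<in> P" for P B
  proof -
    note SD = SD[OF that(1)]
    have n: "insert a B \<notin> P - {B}" using SD(6) by auto
    have "card (f (P, B)) = Suc k"
      using n SD(1,5) that(2) by (simp add: f_def)
    moreover have "disjoint (f (P, B))"
      unfolding f_def disjoint_def using SD(4,6) that(2)
      by (auto simp: disjoint_def)
    moreover have "\<Union>(f (P, B)) = insert a A" "{} \<notin> f (P, B)"
      using SD(2,3) that(2) by (auto simp: f_def)
    ultimately show ?thesis by (simp add: partition_on_def)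
  qed
  have cover: "Q \<in> insert {a} ` S k \<union> f ` (SIGMA P:S (Suc k). P)"
    if Q: "partition_on (insert a A) Q" "card Q = Suc k" for Q
  proof -
    have finQ: "finite Q" using Q(1) finite_elements fin by blast
    from Q(1) obtain C where C: "C \<in> Q" "a \<in> C" by (auto simp: partition_on_def)
    have un: "D = C" if "D \<in> Q" "a \<in> D" for D
      using that C Q(1) by (auto simp: partition_on_def disjoint_def)
    have dis: "D \<inter> C = {}" if "D \<in> Q" "D \<noteq> C" for D
      using that C Q(1) by (auto simp: partition_on_def disjoint_def)
    have ne: "{} \<notin> Q" and dj: "disjoint Q" and UQ: "\<Union>Q = insert a A"
      using Q(1) by (auto simp: partition_on_def)
    have U: "\<Union>(Q - {C}) = A - C"
    proof (intro equalityI subsetI)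
      fix z assume "z \<in> \<Union>(Q - {C})"
      then obtain D where D: "D \<in> Q" "D \<noteq> C" "z \<in> D" by blast
      then have "z \<notin> C" "z \<noteq> a" "z \<in> insert a A" using dis[OF D(1,2)] un[OF D(1)] UQ by blast+
      then show "z \<in> A - C" by blast
    next
      fix z assume z: "z \<in> A - C"
      then have "z \<in> \<Union>Q" using UQ by blast
      then show "z \<in> \<Union>(Q - {C})" using z by blast
    qed
    show ?thesis
    proof (cases "C = {a}")
      case True
      have "Q - {C} \<in> S k"
        using U True a ne dj finQ Q(2) C(1)
        by (auto simp: S_def partition_on_def disjoint_def)
      moreover have "Q = insert {a} (Q - {C})" using True C by auto
      ultimately show ?thesis by blast
    next
      case False
      let ?B = "C - {a}" and ?P = "insert (C - {a}) (Q - {C})"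
      have ne': "?B \<noteq> {}" using False C by auto
      have nin: "?B \<notin> Q"
        using ne' dis by (metis C(2) DiffD2 Diff_subset Int_absorb2 insertI1)
      have "card ?P = Suc k" using nin C finQ Q(2) by (simp add: card_insert_if)
      moreover have "\<Union>?P = A" using U UQ C a by auto
      moreover have "disjoint ?P"
        using dj dis by (auto simp: disjoint_def)
      ultimately have "?P \<in> S (Suc k)"
        using ne ne' by (auto simp: S_def partition_on_def)
      moreover have "Q = f (?P, ?B)"
        using C nin by (auto simp: f_def insert_absorb)
      ultimately show ?thesis by blast
    qed
  qed
  have eq: "{P. partition_on (insert a A) P \<and> card P = Suc k} =
      insert {a} ` S k \<union> f ` (SIGMA P:S (Suc k). P)"
  proof (intro equalityI subsetI)
    fix Q assume "Q \<in> {P. partition_on (insert a A) P \<and> card P = Suc k}"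
    then have "partition_on (insert a A) Q" "card Q = Suc k" by simp_all
    then show "Q \<in> insert {a} ` S k \<union> f ` (SIGMA P:S (Suc k). P)" by (rule cover)
  next
    fix Q assume "Q \<in> insert {a} ` S k \<union> f ` (SIGMA P:S (Suc k). P)"
    then show "Q \<in> {P. partition_on (insert a A) P \<and> card P = Suc k}"
    proof (elim UnE imageE SigmaE)
      fix P assume "Q = insert {a} P" "P \<in> S k"
      then show ?thesis by (simp only: sub1)
    next
      fix z P B assume "Q = f z" "P \<in> S (Suc k)" "B \<in> P" "z = (P, B)"
      then show ?thesis by (simp only: sub2)
    qed
  qed
  have inj1: "inj_on (insert {a}) (S k)"
  proof (rule inj_onI)
    fix P P' assume h: "P \<in> S k" "P' \<in> S k" "insert {a} P = insert {a} P'"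
    have "{a} \<notin> P" "{a} \<notin> P'" using SD(6)[OF h(1)] SD(6)[OF h(2)] by auto
    then show "P = P'" using h(3) by (metis insert_ident)
  qed
  have inj2: "inj_on f (SIGMA P:S (Suc k). P)"
  proof (rule inj_onI, clarify)
    fix P B P' B'
    assume h: "P \<in> S (Suc k)" "B \<in> P" "P' \<in> S (Suc k)" "B' \<in> P'" "f (P, B) = f (P', B')"
    note n = SD(6)[OF h(1)] SD(6)[OF h(3)]
    have e: "insert (insert a B) (P - {B}) = insert (insert a B') (P' - {B'})"
      using h(5) by (simp add: f_def)
    have nin: "insert a B \<notin> P" "insert a B \<notin> P'"
      using n(1)[of "insert a B"] n(2)[of "insert a B"] by (metis insertI1)+
    have "insert a B \<in> insert (insert a B') (P' - {B'})" unfolding e[symmetric] by (rule insertI1)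
    then have "insert a B = insert a B'" using nin(2) by (simp only: insert_iff Diff_iff) simp
    moreover have "a \<notin> B" "a \<notin> B'" using n(1)[OF h(2)] n(2)[OF h(4)] .
    ultimately have B: "B = B'" by (metis insert_ident)
    have "insert a B \<notin> P - {B}" "insert a B \<notin> P' - {B}" using nin by simp_all
    then have "P - {B} = P' - {B}" using e B by (metis insert_ident)
    then show "P = P' \<and> B = B'" using B h(2,4) by blast
  qed
  have dis: "insert {a} ` S k \<inter> f ` (SIGMA P:S (Suc k). P) = {}"
  proof (rule ccontr)
    assume "\<not> ?thesis"
    then obtain P P' B where h: "P' \<in> S (Suc k)" "B \<in> P'" "insert {a} P = f (P', B)" by auto
    have "{a} \<in> f (P', B)" using h(3) by auto
    moreover have "{a} \<notin> P'" using SD(6)[OF h(1)] by auto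
    ultimately have "{a} = insert a B" by (auto simp: f_def)
    then have "B = {}" using SD(6)[OF h(1) h(2)] by auto
    then show False using SD(3)[OF h(1)] h(2) by simp
  qed
  have finP: "finite P" if "P \<in> S m" for P m using SD(1)[OF that] .
  have "card (SIGMA P:S (Suc k). P) = (\<Sum>P\<in>S (Suc k). card P)"
    using finP by (intro card_SigmaI finS ballI) auto
  also have "\<dots> = (\<Sum>P\<in>S (Suc k). Suc k)" by (intro sum.cong) (auto simp: S_def)
  also have "\<dots> = Suc k * card (S (Suc k))" by simp
  finally have cS: "card (SIGMA P:S (Suc k). P) = Suc k * card (S (Suc k))" .
  have "finite (SIGMA P:S (Suc k). P)"
    by (intro finite_SigmaI finS) (rule finP)
  then have "card (insert {a} ` S k \<union> f ` (SIGMA P:S (Suc k). P)) =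
      card (S k) + Suc k * card (S (Suc k))"
    using finS dis cS by (simp add: card_Un_disjoint card_image[OF inj1] card_image[OF inj2])
  then show ?thesis by (simp add: eq S_def)
qed

lemma card_partitions_eq_Stirling:
  assumes "finite A"
  shows "card {P. partition_on A P \<and> card P = k} = Stirling (card A) k"
  using assms
proof (induction A arbitrary: k rule: finite_induct)
  case empty
  have "{P. partition_on ({} :: 'a set) P \<and> card P = k} = (if k = 0 then {{}} else {})"
    by (auto simp: partition_on_empty)
  then show ?case by (cases k) (simp_all only: card.empty if_True if_False nat.distinct, simp_all)
next
  case (insert a A)
  show ?case
  proof (cases k)
    case 0
    have "card P \<noteq> 0" if "partition_on (insert a A) P" for P
      using that finite_elements[OF _ that] insert.hyps(1) by (auto simp: partition_on_def)
    then have "{P. partition_on (insert a A) P \<and> card P = k} = {}" using 0 by auto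
    then have "card {P. partition_on (insert a A) P \<and> card P = k} = 0"
      by (simp only: card.empty)
    moreover have "Stirling (card (insert a A)) k = 0"
      unfolding 0 card_insert_disjoint[OF insert.hyps(1,2)] by (rule Stirling.simps(3))
    ultimately show ?thesis by (rule trans[OF _ sym])
  next
    case (Suc m)
    then show ?thesis using insert card_partitions_insert[OF insert.hyps] by simp
  qed
qed

lemma finite_multi_index_box: "finite {k :: nat^'n. \<forall>i. k $ i \<le> p $ i}"
proof -
  have "finite (vec_lambda ` (PiE (UNIV :: 'n set) (\<lambda>i. {..p $ i})) :: (nat^'n) set)"
    by (intro finite_imageI finite_PiE) auto
  moreover have "k \<in> vec_lambda ` (PiE UNIV (\<lambda>i. {..p $ i}))"
    if "\<forall>i. k $ i \<le> p $ i" for k :: "nat^'n"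
    using that by (intro image_eqI[of _ _ "\<lambda>i. k $ i"]) auto
  ultimately show ?thesis by (auto intro: rev_finite_subset)
qed

end

theory Submission
  imports Defs "HOL-Probability.Product_PMF"
begin

text \<open>
  The negative multinomial law is a Gamma mixture of Poisson laws: if \<open>T\<close> has the Gamma
  distribution with shape \<open>r\<close> and rate \<open>1\<close> and, given \<open>T = t\<close>, the coordinates
  \<open>\<eta>\<^sub>i\<close> are independent and Poisson with mean \<open>y\<^sub>i t\<close>, then \<open>\<eta>\<close> has probability
  mass function \<^const>\<open>neg_multinomial_pmf\<close> (lemma \<open>neg_multinomial_eq_gamma_mixture\<close>).
  This is where the ratios \<open>y\<^sub>i = x\<^sub>i / (1 - l1_norm x)\<close> come from: integrating \<open>t\<close> out
  produces powers of \<open>1 / (1 + \<Sum>\<^sub>i y\<^sub>i) = 1 - l1_norm x\<close>.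

  The \<open>p\<close>-th moment of a Poisson variable with mean \<open>c\<close> is the Touchard polynomial
  \<open>\<Sum>\<^sub>j Stirling p j * c^j\<close>, because powers expand in falling factorials with Stirling
  coefficients and the \<open>j\<close>-th factorial moment is \<open>c^j\<close> (lemma \<open>nn_integral_power_poisson0\<close>).
  By conditional independence, the mixed moment of \<open>\<eta>\<close> given \<open>T = t\<close> is a product of such
  polynomials at \<open>y\<^sub>i t\<close>; expanded over multi-indices \<open>k\<close>, it is a polynomial in \<open>t\<close> whose
  powers are \<open>t^(multi_size k)\<close> (lemma \<open>nn_integral_power_poisson_vec\<close>). Averaging over \<open>T\<close>
  replaces \<open>t^n\<close> by the Gamma moment \<open>Gamma (r + n) / Gamma r\<close>, which is the falling
  factorial in the formula (lemma \<open>falling_factorial_eq_Gamma\<close>).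

  All integrands are nonnegative, so the calculation takes place in \<^typ>\<open>ennreal\<close>: the
  exchange of sum and integral needs no convergence argument, and the finite value obtained at
  the end yields integrability.
\<close>

section \<open>Powers, falling factorials and the exponential series\<close>

lemma falling_factorial_Suc: "falling_factorial m (Suc k) = falling_factorial m k * (m - real k)"
  by (simp add: falling_factorial_def)

text \<open>
  Multiplying a falling factorial by \<open>m = (m - j) + j\<close> gives the next one plus \<open>j\<close> times the
  same one; on coefficients this is the Stirling recurrence.
\<close>

lemma power_eq_sum_Stirling_falling_factorial:
  "m ^ p = (\<Sum>j\<le>p. real (Stirling p j) * falling_factorial m j)"
proof (induction p)
  case 0
  then show ?case by (simp add: falling_factorial_def)
next
  case (Suc p)
  let ?F = "falling_factorial m"
  have "m ^ Suc p = (\<Sum>j\<le>p. real (Stirling p j) * (m * ?F j))"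
    by (simp add: Suc sum_distrib_left mult_ac)
  also have "\<dots> =
      (\<Sum>j\<le>p. real (Stirling p j) * ?F (Suc j)) + (\<Sum>j\<le>p. real j * real (Stirling p j) * ?F j)"
    by (simp add: falling_factorial_Suc sum.distrib[symmetric] algebra_simps)
  \<comment> \<open>The extra summand is zero because \<open>Stirling p (Suc p) = 0\<close>; it aligns the index ranges.\<close>
  also have "(\<Sum>j\<le>p. real j * real (Stirling p j) * ?F j)
      = (\<Sum>j\<le>Suc p. real j * real (Stirling p j) * ?F j)"
    by simp
  also have "\<dots> = (\<Sum>j\<le>p. real (Suc j) * real (Stirling p (Suc j)) * ?F (Suc j))"
    by (simp only: sum.atMost_Suc_shift)
  also have "(\<Sum>j\<le>p. real (Stirling p j) * ?F (Suc j)) + \<dots>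
      = (\<Sum>j\<le>p. real (Stirling (Suc p) (Suc j)) * ?F (Suc j))"
    by (simp add: sum.distrib[symmetric] algebra_simps)
  also have "\<dots> = (\<Sum>j\<le>Suc p. real (Stirling (Suc p) j) * ?F j)"
    by (simp only: sum.atMost_Suc_shift) simp
  finally show ?case .
qed

lemma falling_factorial_of_nat_less: "n < j \<Longrightarrow> falling_factorial (real n) j = 0"
  by (auto simp: falling_factorial_def)

lemma falling_factorial_of_nat_add: "falling_factorial (real (n + j)) j = fact (n + j) / fact n"
proof (induction j arbitrary: n)
  case 0
  then show ?case by (simp add: falling_factorial_def)
next
  case (Suc j)
  have "falling_factorial (real (n + Suc j)) (Suc j) =
      falling_factorial (real (Suc n + j)) j * real (Suc n)"
    by (simp add: falling_factorial_Suc)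
  also have "\<dots> = fact (n + Suc j) / fact n"
    unfolding Suc by (simp add: divide_simps)
  finally show ?case .
qed

text \<open>
  Factorial moments of the Poisson law, without the normalizing factor: the falling factorial
  removes the terms below \<open>j\<close> and cancels \<open>j\<close> factors of each remaining \<open>fact n\<close>, which
  leaves the exponential series shifted by \<open>j\<close>.
\<close>

lemma sums_falling_factorial_exp:
  "(\<lambda>n. falling_factorial (real n) j * (c ^ n / fact n)) sums (c ^ j * exp c)"
proof -
  have "(\<lambda>n. c ^ j * (c ^ n / fact n)) sums (c ^ j * exp c)"
    using exp_converges[of c] by (intro sums_mult) (simp add: field_simps)
  also have "(\<lambda>n. c ^ j * (c ^ n / fact n)) =
      (\<lambda>n. falling_factorial (real (n + j)) j * (c ^ (n + j) / fact (n + j)))"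
    unfolding falling_factorial_of_nat_add by (simp add: power_add field_simps)
  finally show ?thesis
    by (subst (asm) sums_iff_shift) (simp add: falling_factorial_of_nat_less)
qed

lemma sums_power_exp:
  "(\<lambda>n. real n ^ p * (c ^ n / fact n)) sums (exp c * (\<Sum>j\<le>p. real (Stirling p j) * c ^ j))"
proof -
  have "(\<lambda>n. \<Sum>j\<le>p. real (Stirling p j) * (falling_factorial (real n) j * (c ^ n / fact n)))
      sums (\<Sum>j\<le>p. real (Stirling p j) * (c ^ j * exp c))"
    by (intro sums_sum sums_mult sums_falling_factorial_exp)
  moreover have "(\<Sum>j\<le>p. real (Stirling p j) * (falling_factorial (real n) j * (c ^ n / fact n)))
      = real n ^ p * (c ^ n / fact n)" for n
    unfolding power_eq_sum_Stirling_falling_factorial[of "real n"] sum_distrib_right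
    by (simp only: mult.assoc)
  moreover have "(\<Sum>j\<le>p. real (Stirling p j) * (c ^ j * exp c)) =
      exp c * (\<Sum>j\<le>p. real (Stirling p j) * c ^ j)"
    by (simp add: sum_distrib_left mult_ac)
  ultimately show ?thesis
    by simp
qed

section \<open>Moments of Poisson laws\<close>

text \<open>
  \<^const>\<open>poisson_pmf\<close> is meaningful for positive rates. The rates \<open>y\<^sub>i t\<close> may vanish, hence the
  extension by the point mass at \<open>0\<close>, which obeys the same formula (with \<open>0 ^ 0 = 1\<close>).
\<close>

definition poisson0_pmf :: "real \<Rightarrow> nat pmf" where
  "poisson0_pmf c = (if c = 0 then return_pmf 0 else poisson_pmf c)"

lemma pmf_poisson0:
  assumes "c \<ge> 0"
  shows "pmf (poisson0_pmf c) n = c ^ n / fact n * exp (- c)"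
  using assms by (cases "c = 0") (auto simp: poisson0_pmf_def pmf_return indicator_def power_0_left)

lemma nn_integral_power_poisson0:
  assumes "c \<ge> 0"
  shows "(\<integral>\<^sup>+n. ennreal (real n ^ p) \<partial>poisson0_pmf c) =
    ennreal (\<Sum>j\<le>p. real (Stirling p j) * c ^ j)"
proof -
  have "(\<lambda>n. exp (- c) * (real n ^ p * (c ^ n / fact n))) sums
      (exp (- c) * (exp c * (\<Sum>j\<le>p. real (Stirling p j) * c ^ j)))"
    by (intro sums_mult sums_power_exp)
  also have "exp (- c) * (exp c * (\<Sum>j\<le>p. real (Stirling p j) * c ^ j)) =
      (\<Sum>j\<le>p. real (Stirling p j) * c ^ j)"
    by (simp add: exp_minus)
  finally have "(\<Sum>n. ennreal (exp (- c) * (real n ^ p * (c ^ n / fact n))))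
      = ennreal (\<Sum>j\<le>p. real (Stirling p j) * c ^ j)"
    using assms by (intro suminf_ennreal_eq) auto
  then show ?thesis
    using assms
    by (simp add: nn_integral_measure_pmf nn_integral_count_space_nat pmf_poisson0
        flip: ennreal_mult') (simp add: mult_ac)
qed

section \<open>Products over multi-indices\<close>

text \<open>
  Independence in the form of a sum over \<^typ>\<open>'a^'n\<close>: the product of the mass functions is
  that of \<^const>\<open>Pi_pmf\<close> on the full index set, where expectations of products factor.
\<close>

lemma nn_integral_prod_pmf_vec:
  fixes q :: "'n::finite \<Rightarrow> 'a pmf" and f :: "'n \<Rightarrow> 'a \<Rightarrow> ennreal"
  shows "(\<integral>\<^sup>+k. ennreal (\<Prod>i\<in>UNIV. pmf (q i) (k $ i)) * (\<Prod>i\<in>UNIV. f i (k $ i))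
      \<partial>count_space (UNIV :: ('a^'n) set))
    = (\<Prod>i\<in>UNIV. \<integral>\<^sup>+n. f i n \<partial>q i)"
proof -
  have bij: "bij_betw vec_lambda (UNIV :: ('n \<Rightarrow> 'a) set) (UNIV :: ('a^'n) set)"
    by (rule bij_betwI[where g = vec_nth]) auto
  have "(\<Prod>i\<in>UNIV. \<integral>\<^sup>+n. f i n \<partial>q i) =
      (\<integral>\<^sup>+g. (\<Prod>i\<in>UNIV. f i (g i)) \<partial>Pi_pmf UNIV undefined q)"
    by (rule nn_integral_prod_Pi_pmf[symmetric]) simp
  also have "\<dots> = (\<integral>\<^sup>+g. ennreal (\<Prod>i\<in>UNIV. pmf (q i) (g i)) * (\<Prod>i\<in>UNIV. f i (g i))
      \<partial>count_space UNIV)"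
    by (simp add: nn_integral_measure_pmf pmf_Pi)
  also have "\<dots> = (\<integral>\<^sup>+k. ennreal (\<Prod>i\<in>UNIV. pmf (q i) (k $ i)) * (\<Prod>i\<in>UNIV. f i (k $ i))
      \<partial>count_space (UNIV :: ('a^'n) set))"
    by (subst nn_integral_bij_count_space[OF bij, symmetric]) simp
  finally show ?thesis ..
qed

lemma prod_sum_vec:
  fixes f :: "'n::finite \<Rightarrow> nat \<Rightarrow> 'a::comm_semiring_1" and p :: "nat^'n"
  shows "(\<Prod>i\<in>UNIV. \<Sum>j\<le>p $ i. f i j) = (\<Sum>k | \<forall>i. k $ i \<le> p $ i. \<Prod>i\<in>UNIV. f i (k $ i))"
proof -
  have "(\<Prod>i\<in>UNIV. \<Sum>j\<le>p $ i. f i j) = (\<Sum>g\<in>PiE UNIV (\<lambda>i. {..p $ i}). \<Prod>i\<in>UNIV. f i (g i))"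
    by (rule prod_sum_PiE) auto
  also have "\<dots> = (\<Sum>k | \<forall>i. k $ i \<le> p $ i. \<Prod>i\<in>UNIV. f i (k $ i))"
    by (rule sum.reindex_bij_witness[of _ vec_nth vec_lambda]) auto
  finally show ?thesis .
qed

section \<open>The Gamma distribution\<close>

lemma nn_integral_powr_exp:
  assumes "a > 0" "c > 0"
  shows "(\<integral>\<^sup>+t. ennreal (indicator {0..} t * (t powr (a - 1) * exp (- c * t))) \<partial>lborel) =
    ennreal (Gamma a / c powr a)"
proof -
  let ?f = "\<lambda>t::real. indicator {0..} t * (t powr (a - 1) / exp t) :: real"
  have "ennreal (Gamma a) = (\<integral>\<^sup>+t. ennreal (?f t) \<partial>lborel)"
    using nn_integral_has_integral_lebesgue[OF _ Gamma_integral_real[OF assms(1)]] by simp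
  also have "\<dots> = ennreal \<bar>c\<bar> * (\<integral>\<^sup>+t. ennreal (?f (0 + c * t)) \<partial>lborel)"
    using assms by (intro nn_integral_real_affine) auto
  also have "\<dots> = (\<integral>\<^sup>+t. ennreal \<bar>c\<bar> * ennreal (?f (0 + c * t)) \<partial>lborel)"
    by (rule nn_integral_cmult[symmetric]) measurable
  also have "\<dots> = (\<integral>\<^sup>+t. ennreal (c powr a) *
      ennreal (indicator {0..} t * (t powr (a - 1) * exp (- c * t))) \<partial>lborel)"
  proof (intro nn_integral_cong)
    fix t :: real
    have "c * c powr (a - 1) = c powr a"
      using assms by (simp add: powr_mult_base)
    then have "\<bar>c\<bar> * ?f (0 + c * t) =
        c powr a * (indicator {0..} t * (t powr (a - 1) * exp (- c * t)))"
      using assms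
      by (auto simp: indicator_def zero_le_mult_iff powr_mult exp_minus field_simps)
    then show "ennreal \<bar>c\<bar> * ennreal (?f (0 + c * t)) =
        ennreal (c powr a) * ennreal (indicator {0..} t * (t powr (a - 1) * exp (- c * t)))"
      by (simp only: ennreal_mult'[symmetric] abs_ge_zero powr_ge_zero)
  qed
  also have "\<dots> = ennreal (c powr a) *
      (\<integral>\<^sup>+t. ennreal (indicator {0..} t * (t powr (a - 1) * exp (- c * t))) \<partial>lborel)"
    by (rule nn_integral_cmult) measurable
  finally have "ennreal (1 / c powr a) * ennreal (Gamma a) = ennreal (1 / c powr a) * \<dots>"
    by simp
  then show ?thesis
    using assms by (simp add: mult.assoc[symmetric] ennreal_mult'[symmetric])
qed

text \<open>
  Read from its smallest factor upwards, the falling factorial of \<open>r - 1 + n\<close> is the rising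
  factorial \<open>r (r + 1) \<cdots> (r + n - 1)\<close>.
\<close>

lemma falling_factorial_eq_Gamma:
  assumes "r > 0"
  shows "falling_factorial (r - 1 + real n) n = Gamma (r + real n) / Gamma r"
proof -
  have "falling_factorial (r - 1 + real n) n = pochhammer r n"
    unfolding falling_factorial_def pochhammer_prod atLeast0LessThan
    by (subst prod.nat_diff_reindex[symmetric]) (auto intro!: prod.cong simp: of_nat_diff)
  also have "\<dots> = Gamma (r + real n) / Gamma r"
    using assms by (intro pochhammer_Gamma) auto
  finally show ?thesis .
qed

text \<open>Shape \<open>r\<close>, rate \<open>1\<close>.\<close>

definition gamma_density :: "real \<Rightarrow> real \<Rightarrow> real" where
  "gamma_density r t = indicator {0..} t * (t powr (r - 1) * exp (- t)) / Gamma r"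

lemma gamma_density_nonneg: "r > 0 \<Longrightarrow> gamma_density r t \<ge> 0"
  by (simp add: gamma_density_def Gamma_real_pos)

lemma gamma_density_measurable [measurable]: "gamma_density r \<in> borel_measurable borel"
  unfolding gamma_density_def by measurable

text \<open>
  One integral for two purposes: with \<open>c = 0\<close> it gives the moments of the Gamma law, and with
  \<open>c = \<Sum>\<^sub>i y\<^sub>i\<close> it integrates the exponential factor of the Poisson weights.
\<close>

lemma nn_integral_gamma_density:
  assumes "r > 0" "c > - 1"
  shows "(\<integral>\<^sup>+t. ennreal (gamma_density r t * (t ^ n * exp (- c * t))) \<partial>lborel)
     = ennreal (Gamma (r + real n) / (Gamma r * (1 + c) powr (r + real n)))"
proof -
  have "(\<integral>\<^sup>+t. ennreal (gamma_density r t * (t ^ n * exp (- c * t))) \<partial>lborel)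
    = (\<integral>\<^sup>+t. ennreal (1 / Gamma r) *
        ennreal (indicator {0..} t * (t powr (r + real n - 1) * exp (- (1 + c) * t))) \<partial>lborel)"
    \<comment> \<open>The point \<open>t = 0\<close> is excluded: there \<open>t powr (r - 1) * t ^ n = t powr (r + n - 1)\<close>
      still holds, but \<^const>\<open>powr\<close> and powers combine only for positive bases.\<close>
  proof (intro nn_integral_cong_AE AE_I[where N = "{0}"] subsetI CollectI; (simp; fail)?)
    fix t :: real
    assume *: "t \<in> {t \<in> space lborel. ennreal (gamma_density r t * (t ^ n * exp (- c * t))) \<noteq>
        ennreal (1 / Gamma r) *
        ennreal (indicator {0..} t * (t powr (r + real n - 1) * exp (- (1 + c) * t)))}"
    have "gamma_density r t * (t ^ n * exp (- c * t)) =
        1 / Gamma r * (indicator {0..} t * (t powr (r + real n - 1) * exp (- (1 + c) * t)))"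
      if "t > 0"
    proof -
      have "t powr (r - 1) * t ^ n = t powr (r + real n - 1)"
        using that by (simp add: powr_realpow[symmetric] powr_add[symmetric] algebra_simps)
      moreover have "exp (- t) * exp (- c * t) = exp (- (1 + c) * t)"
        by (simp add: exp_add[symmetric] algebra_simps)
      ultimately have "(t powr (r - 1) * t ^ n) * (exp (- t) * exp (- c * t))
          = t powr (r + real n - 1) * exp (- (1 + c) * t)"
        by (simp only:)
      then show ?thesis
        using that by (simp add: gamma_density_def mult_ac)
    qed
    moreover have "gamma_density r t = 0" "indicator {0..} t = (0::real)" if "t < 0"
      using that by (simp_all add: gamma_density_def)
    ultimately show "t \<in> {0}"
      using * assms(1) by (cases t "0::real" rule: linorder_cases)
        (auto simp: ennreal_mult'[symmetric] Gamma_real_pos)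
  qed
  also have "\<dots> = ennreal (1 / Gamma r) * ennreal (Gamma (r + real n) / (1 + c) powr (r + real n))"
    using assms nn_integral_powr_exp[of "r + real n" "1 + c"]
    by (subst nn_integral_cmult) simp_all
  finally show ?thesis
    using assms by (simp add: ennreal_mult'[symmetric] Gamma_real_pos)
qed

section \<open>The negative multinomial law as a Gamma mixture of Poisson laws\<close>

text \<open>The conditional law of \<open>\<eta>\<close> given that the mixing variable equals \<open>t\<close>.\<close>

definition poisson_vec_mass :: "real^'n \<Rightarrow> real \<Rightarrow> nat^'n \<Rightarrow> real" where
  "poisson_vec_mass y t k = (\<Prod>i\<in>UNIV. pmf (poisson0_pmf (y $ i * t)) (k $ i))"

text \<open>
  As a function of \<open>t \<ge> 0\<close>, the Poisson weight of \<open>k\<close> is a constant times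
  \<open>t^(multi_size k) * exp (- (\<Sum>\<^sub>i y\<^sub>i) t)\<close>, so the mixture is a single Gamma integral with rate
  \<open>1 + \<Sum>\<^sub>i y\<^sub>i = 1 / (1 - l1_norm x)\<close>. The resulting power \<open>(1 - l1_norm x) powr (r + multi_size k)\<close>
  splits into the normalizing factor of the mass function and the factors that turn each
  \<open>y\<^sub>i\<close> back into \<open>x\<^sub>i\<close>.
\<close>

lemma neg_multinomial_eq_gamma_mixture:
  fixes x y :: "real^'n"
  assumes "r > 0" "\<And>i. x $ i \<ge> 0" "l1_norm x < 1"
    and y: "\<And>i. y $ i = x $ i / (1 - l1_norm x)"
  shows "ennreal (neg_multinomial_pmf r x k) =
    (\<integral>\<^sup>+t. ennreal (gamma_density r t) * ennreal (poisson_vec_mass y t k) \<partial>lborel)"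
proof -
  note r = \<open>r > 0\<close>
  define s where "s = l1_norm x"
  define S where "S = (\<Sum>i\<in>UNIV. y $ i)"
  let ?m = "multi_size k"
  have s: "s < 1" and "s \<ge> 0" and s_sum: "s = (\<Sum>i\<in>UNIV. x $ i)"
    using assms by (auto simp: s_def l1_norm_def sum_nonneg)
  have y_nonneg: "y $ i \<ge> 0" for i
    using assms by simp
  have "S = s / (1 - s)"
    unfolding S_def y s_def[symmetric] s_sum by (simp add: sum_divide_distrib)
  then have S: "1 + S = 1 / (1 - s)"
    using s by (simp add: field_simps)
  have "S \<ge> 0"
    unfolding S_def using y_nonneg by (simp add: sum_nonneg)
  let ?C = "\<Prod>i\<in>UNIV. (y $ i) ^ (k $ i) / fact (k $ i)"
  have C: "?C \<ge> 0"
    using y_nonneg by (intro prod_nonneg) simp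
  have poisson: "poisson_vec_mass y t k = ?C * (t ^ ?m * exp (- S * t))" if "t \<ge> 0" for t
  proof -
    have "poisson_vec_mass y t k =
        (\<Prod>i\<in>UNIV. (y $ i) ^ (k $ i) / fact (k $ i) * (t ^ (k $ i) * exp (- (y $ i * t))))"
      using y_nonneg that
      by (simp add: poisson_vec_mass_def pmf_poisson0 power_mult_distrib mult_ac)
    also have "\<dots> = ?C * ((\<Prod>i\<in>UNIV. t ^ (k $ i)) * (\<Prod>i\<in>UNIV. exp (- (y $ i * t))))"
      by (simp only: prod.distrib)
    also have "\<dots> = ?C * (t ^ ?m * exp (- S * t))"
      by (simp add: multi_size_def S_def power_sum exp_sum[symmetric] sum_distrib_right sum_negf)
    finally show ?thesis .
  qed
  have "(\<integral>\<^sup>+t. ennreal (gamma_density r t) * ennreal (poisson_vec_mass y t k) \<partial>lborel)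
    = (\<integral>\<^sup>+t. ennreal ?C * ennreal (gamma_density r t * (t ^ ?m * exp (- S * t))) \<partial>lborel)"
  proof (intro nn_integral_cong)
    fix t :: real
    show "ennreal (gamma_density r t) * ennreal (poisson_vec_mass y t k)
      = ennreal ?C * ennreal (gamma_density r t * (t ^ ?m * exp (- S * t)))"
    proof (cases "t \<ge> 0")
      case True
      then show ?thesis
        using C gamma_density_nonneg[OF assms(1), of t]
        by (simp add: poisson ennreal_mult'[symmetric] mult_ac)
    next
      case False
      then show ?thesis
        by (simp add: gamma_density_def)
    qed
  qed
  also have "\<dots> = ennreal ?C * ennreal (Gamma (r + real ?m) / (Gamma r * (1 + S) powr (r + real ?m)))"
    using nn_integral_gamma_density[OF r, of S ?m] \<open>S \<ge> 0\<close>
    by (subst nn_integral_cmult) simp_all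
  also have "\<dots> = ennreal (?C * (Gamma (r + real ?m) / (Gamma r * (1 + S) powr (r + real ?m))))"
    by (rule ennreal_mult'[OF C, symmetric])
  also have "?C * (Gamma (r + real ?m) / (Gamma r * (1 + S) powr (r + real ?m))) =
      neg_multinomial_pmf r x k"
  proof -
    have "?C = (\<Prod>i\<in>UNIV. (x $ i) ^ (k $ i)) / ((1 - s) ^ ?m * (\<Prod>i\<in>UNIV. fact (k $ i)))"
      by (simp add: y s_def multi_size_def power_sum power_divide prod_dividef prod.distrib)
    moreover have "(1 + S) powr (r + real ?m) = 1 / ((1 - s) powr r * (1 - s) ^ ?m)"
      using s by (simp add: S powr_divide powr_add powr_realpow)
    moreover have "Gamma (real (k $ i) + 1) = fact (k $ i)" for i
      by (simp add: Gamma_fact add.commute)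
    ultimately show ?thesis
      using s by (simp add: neg_multinomial_pmf_def s_def mult_ac)
  qed
  finally show ?thesis ..
qed

text \<open>
  The mixed moment given \<open>t\<close>, arranged by powers of \<open>t\<close> so that it can be averaged over the
  Gamma law term by term.
\<close>

lemma nn_integral_power_poisson_vec:
  assumes "\<And>i. y $ i \<ge> 0" "t \<ge> 0"
  shows "(\<integral>\<^sup>+k. ennreal (poisson_vec_mass y t k) * ennreal (\<Prod>i\<in>UNIV. real (k $ i) ^ (p $ i))
      \<partial>count_space UNIV)
    = ennreal (\<Sum>k | \<forall>i. k $ i \<le> p $ i. (\<Prod>i\<in>UNIV. real (Stirling (p $ i) (k $ i)) * (y $ i) ^ (k $ i)) *
        t ^ multi_size k)"
proof -
  have "(\<integral>\<^sup>+k. ennreal (poisson_vec_mass y t k) * ennreal (\<Prod>i\<in>UNIV. real (k $ i) ^ (p $ i))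
      \<partial>count_space UNIV)
     = (\<Prod>i\<in>UNIV. \<integral>\<^sup>+n. ennreal (real n ^ (p $ i)) \<partial>poisson0_pmf (y $ i * t))"
    unfolding poisson_vec_mass_def nn_integral_prod_pmf_vec[symmetric] by (simp add: prod_ennreal)
  also have "\<dots> = (\<Prod>i\<in>UNIV. ennreal (\<Sum>j\<le>p $ i. real (Stirling (p $ i) j) * (y $ i * t) ^ j))"
    using assms by (simp add: nn_integral_power_poisson0)
  also have "\<dots> = ennreal (\<Prod>i\<in>UNIV. \<Sum>j\<le>p $ i. real (Stirling (p $ i) j) * (y $ i * t) ^ j)"
    using assms by (intro prod_ennreal sum_nonneg) simp
  also have "(\<Prod>i\<in>UNIV. \<Sum>j\<le>p $ i. real (Stirling (p $ i) j) * (y $ i * t) ^ j)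
    = (\<Sum>k | \<forall>i. k $ i \<le> p $ i. (\<Prod>i\<in>UNIV. real (Stirling (p $ i) (k $ i)) * (y $ i) ^ (k $ i)) *
        t ^ multi_size k)"
    by (simp add: prod_sum_vec multi_size_def power_sum power_mult_distrib prod.distrib mult_ac)
  finally show ?thesis .
qed

text \<open>
  The weight of \<open>k\<close> has the explicit continuous form only for \<open>t \<ge> 0\<close>; for negative rates
  \<^const>\<open>poisson_pmf\<close> is unspecified. The density in front, which vanishes there, makes the
  product measurable.
\<close>

lemma gamma_density_poisson_vec_measurable [measurable]:
  assumes "\<And>i. y $ i \<ge> 0"
  shows "(\<lambda>t. ennreal (gamma_density r t) * ennreal (poisson_vec_mass y t k)) \<in> borel_measurable borel"
proof -
  have "(\<lambda>t. ennreal (gamma_density r t) * ennreal (poisson_vec_mass y t k)) =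
    (\<lambda>t. ennreal (gamma_density r t) *
        ennreal (\<Prod>i\<in>UNIV. (y $ i * t) ^ (k $ i) / fact (k $ i) * exp (- (y $ i * t))))"
  proof
    fix t :: real
    show "ennreal (gamma_density r t) * ennreal (poisson_vec_mass y t k) =
      ennreal (gamma_density r t) *
        ennreal (\<Prod>i\<in>UNIV. (y $ i * t) ^ (k $ i) / fact (k $ i) * exp (- (y $ i * t)))"
      using assms by (cases "t \<ge> 0") (simp_all add: poisson_vec_mass_def pmf_poisson0 gamma_density_def)
  qed
  then show ?thesis
    by simp
qed

section \<open>Mixed moments\<close>

theorem theorem1:
  fixes M :: "'w measure"
    and r :: real
    and x y :: "real^'n"
    and \<eta> :: "'w \<Rightarrow> nat^'n"
    and p :: "nat^'n"
  assumes "prob_space M"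
    and "r > 0"
    and "\<And>i. x $ i \<in> {0..1}"
    and "l1_norm x < 1"
    and "distributed M (count_space UNIV) \<eta> (\<lambda>k. ennreal (neg_multinomial_pmf r x k))"
    and "\<And>i. y $ i = x $ i / (1 - l1_norm x)"
  shows "integrable M (\<lambda>\<omega>. \<Prod>i\<in>UNIV. real (\<eta> \<omega> $ i) ^ (p $ i)) \<and>
    prob_space.expectation M (\<lambda>\<omega>. \<Prod>i\<in>UNIV. real (\<eta> \<omega> $ i) ^ (p $ i)) =
      (\<Sum>k | \<forall>i. k $ i \<le> p $ i.
         falling_factorial (r - 1 + real (multi_size k)) (multi_size k) *
         (\<Prod>i\<in>UNIV. real (Stirling (p $ i) (k $ i)) * (y $ i) ^ (k $ i)))"
proof -
  note r = \<open>r > 0\<close>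
  define c where "c k = (\<Prod>i\<in>UNIV. real (Stirling (p $ i) (k $ i)) * (y $ i) ^ (k $ i))" for k
  define powers where "powers k = (\<Prod>i\<in>UNIV. real (k $ i) ^ (p $ i))" for k :: "nat^'n"
  let ?box = "{k. \<forall>i. k $ i \<le> p $ i}"
  have x: "x $ i \<ge> 0" for i
    using assms(3)[of i] by simp
  have y: "y $ i \<ge> 0" for i
    using x assms(4,6) by simp
  have c: "c k \<ge> 0" for k
    unfolding c_def using y by (intro prod_nonneg) simp
  have \<eta>: "\<eta> \<in> measurable M (count_space UNIV)"
    using assms(5) by (rule distributed_measurable)
  have "(\<integral>\<^sup>+\<omega>. ennreal (powers (\<eta> \<omega>)) \<partial>M)
    = (\<integral>\<^sup>+k. ennreal (neg_multinomial_pmf r x k) * ennreal (powers k) \<partial>count_space UNIV)"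
    by (rule distributed_nn_integral[OF assms(5), symmetric]) simp
  also have "\<dots> = (\<integral>\<^sup>+k. (\<integral>\<^sup>+t. ennreal (gamma_density r t) * ennreal (poisson_vec_mass y t k) * ennreal (powers k)
        \<partial>lborel) \<partial>count_space UNIV)"
    using y by (simp add: neg_multinomial_eq_gamma_mixture[OF r x assms(4,6)] nn_integral_multc)
  also have "\<dots> = (\<integral>\<^sup>+t. (\<integral>\<^sup>+k. ennreal (gamma_density r t) * ennreal (poisson_vec_mass y t k) * ennreal (powers k)
        \<partial>count_space UNIV) \<partial>lborel)"
    using y by (intro nn_integral_count_space_nn_integral[symmetric]) auto
  \<comment> \<open>The factor \<open>exp (- 0 * t)\<close> puts the integrand in the shape of \<open>nn_integral_gamma_density\<close>.\<close>
  also have "\<dots> = (\<integral>\<^sup>+t. (\<Sum>k\<in>?box. ennreal (c k) *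
      ennreal (gamma_density r t * (t ^ multi_size k * exp (- 0 * t)))) \<partial>lborel)"
  proof (intro nn_integral_cong)
    fix t :: real
    show "(\<integral>\<^sup>+k. ennreal (gamma_density r t) * ennreal (poisson_vec_mass y t k) * ennreal (powers k)
        \<partial>count_space UNIV)
      = (\<Sum>k\<in>?box. ennreal (c k) * ennreal (gamma_density r t * (t ^ multi_size k * exp (- 0 * t))))"
    proof (cases "t \<ge> 0")
      case True
      have "(\<integral>\<^sup>+k. ennreal (gamma_density r t) * ennreal (poisson_vec_mass y t k) * ennreal (powers k)
        \<partial>count_space UNIV)
        = ennreal (gamma_density r t) * ennreal (\<Sum>k\<in>?box. c k * t ^ multi_size k)"
        unfolding c_def powers_def nn_integral_power_poisson_vec[OF y True, symmetric]
        by (simp add: mult.assoc nn_integral_cmult)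
      also have "\<dots> = (\<Sum>k\<in>?box. ennreal (c k * (gamma_density r t * t ^ multi_size k)))"
        using c True gamma_density_nonneg[OF r, of t]
        by (simp add: ennreal_mult'[symmetric] sum_distrib_left mult_ac sum_nonneg)
      finally show ?thesis
        using c by (simp add: ennreal_mult')
    next
      case False
      then show ?thesis
        by (simp add: gamma_density_def)
    qed
  qed
  also have "\<dots> = (\<Sum>k\<in>?box. ennreal (c k) * ennreal (Gamma (r + real (multi_size k)) / Gamma r))"
    using nn_integral_gamma_density[OF r, of 0]
    by (subst nn_integral_sum) (simp_all add: nn_integral_cmult)
  also have "\<dots> = (\<Sum>k\<in>?box. ennreal (falling_factorial (r - 1 + real (multi_size k)) (multi_size k) * c k))"
    using c by (simp add: falling_factorial_eq_Gamma[OF r] ennreal_mult'[symmetric] mult.commute)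
  also have "\<dots> = ennreal (\<Sum>k\<in>?box. falling_factorial (r - 1 + real (multi_size k)) (multi_size k) * c k)"
    using c r by (intro sum_ennreal) (simp add: falling_factorial_eq_Gamma Gamma_real_pos)
  finally have *: "(\<integral>\<^sup>+\<omega>. ennreal (powers (\<eta> \<omega>)) \<partial>M) = \<dots>" .
  have "(\<lambda>\<omega>. powers (\<eta> \<omega>)) \<in> borel_measurable M"
    using \<eta> by (rule measurable_compose) simp
  moreover have "powers k \<ge> 0" for k
    by (simp add: powers_def prod_nonneg)
  moreover have "(\<Sum>k\<in>?box. falling_factorial (r - 1 + real (multi_size k)) (multi_size k) * c k) \<ge> 0"
    using c r by (intro sum_nonneg) (simp add: falling_factorial_eq_Gamma Gamma_real_pos)
  ultimately have "integrable M (\<lambda>\<omega>. powers (\<eta> \<omega>)) \<and> (\<integral>\<omega>. powers (\<eta> \<omega>) \<partial>M)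
      = (\<Sum>k\<in>?box. falling_factorial (r - 1 + real (multi_size k)) (multi_size k) * c k)"
    using * by (subst nn_integral_eq_integrable[symmetric]) auto
  then show ?thesis
    by (simp only: powers_def c_def)
qed

end
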